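(* Let $\mathcal{G}=(V,E,\Phi,\chi)$ be a decision network, let $u\in V$ be a node with neighbors $\mathcal{N}(u)=\{v_1,\ldots,v_d\}$. For every $x\in\chi$, $$B_{\mathcal{G},u}(x)=\Phi_u(x)-\Phi_u(0)+\sum_{j=1}^d\mu_{u\leftarrow v_j}\big(x,B_{\mathcal{G}(u,j,x),v_j}\big).$$
   Context: A decision network $\mathcal{G}=(V,E,\Phi,\chi)$ consists of a finite undirected simple graph $(V,E)$, a finite action set $\chi=\{0,1,\ldots,T-1\}$, a potential function $\Phi_v:\chi\to\mathbb{R}$ for every $v\in V$ and an interaction function $\Phi_e:\chi^2\to\mathbb{R}\cup\{-\infty\}$ for every $e\in E$ (in modified networks potential functions may also take the value $-\infty$). $F_{\mathcal{G}}(\mathbf{x})=\sum_{(u,v)\in E}\Phi_{u,v}(x_u,x_v)+\sum_{v\in V}\Phi_v(x_v)$ for $\mathbf{x}\in\chi^V$. For $v\in V$, $x\in\chi$, $J_{\mathcal{G},v}(x)=\max_{\mathbf{x}:x_v=x}F_{\mathcal{G}}(\mathbf{x})$. The cavity of action $x$ at $v$ is $B_{\mathcal{G},v}(x)=J_{\mathcal{G},v}(x)-J_{\mathcal{G},v}(0)$, and $B_{\mathcal{G},v}=(B_{\mathcal{G},v}(x))_{x\in\chi}$. For an edge $(u,v)$ and a vector $B=(B(y))_{y\in\chi}$, the partial cavity function is $$\mu_{u\leftarrow v}(x,B)=\max_{y\in\chi}(\Phi_{u,v}(x,y)+B(y))-\max_{y\in\chi}(\Phi_{u,v}(0,y)+B(y)).$$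 For $\mathcal{N}(u)=\{v_1,\ldots,v_d\}$ (in a fixed order), $1\le j\le d$ and $x\in\chi$, $\mathcal{G}(u,j,x)$ is the decision network on the subgraph induced by $V\setminus\{u\}$, with the same action set and the same interaction functions on the remaining edges, and with potential functions $\Phi'_v$ given by: $\Phi'_v(y)=\Phi_v(y)+\Phi_{u,v}(x,y)$ for $v\in\{v_1,\ldots,v_{j-1}\}$; $\Phi'_v(y)=\Phi_v(y)+\Phi_{u,v}(0,y)$ for $v\in\{v_{j+1},\ldots,v_d\}$; $\Phi'_v=\Phi_v$ for all other $v$ (including $v_j$). All differences are understood to be well defined, i.e. no expression $(-\infty)-(-\infty)$ occurs. *)

theory Defs
  imports Complex_Main "HOL-Library.Extended_Real" "HOL-Library.FuncSet"
begin

(* The action set is {0, ..., num_actions - 1}.  The interaction function of the edge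
   {a, b} is available under both orientations: inter a b x y is its value when a plays x
   and b plays y, whence the symmetry condition below. *)

record 'v net =
  verts :: "'v set"
  edges :: "'v set set"
  num_actions :: nat
  pot :: "'v \<Rightarrow> nat \<Rightarrow> ereal"
  inter :: "'v \<Rightarrow> 'v \<Rightarrow> nat \<Rightarrow> nat \<Rightarrow> ereal"

definition actions :: "'v net \<Rightarrow> nat set" where
  "actions N = {..<num_actions N}"

(* Potentials take values in the reals extended by minus infinity, so that networks with
   real potentials and the modified networks obtained from them are covered alike. *)

locale decision_network =
  fixes N :: "'v net"
  assumes finite_verts: "finite (verts N)"
    and edges_simple: "e \<in> edges N \<Longrightarrow> e \<subseteq> verts N \<and> card e = 2"
    and actions_nonempty: "0 < num_actions N"
    and pot_not_PInf: "v \<in> verts N \<Longrightarrow> x \<in> actions N \<Longrightarrow> pot N v x \<noteq> \<infinity>"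
    and inter_not_PInf: "{a, b} \<in> edges N \<Longrightarrow> x \<in> actions N \<Longrightarrow> y \<in> actions N
           \<Longrightarrow> inter N a b x y \<noteq> \<infinity>"
    and inter_sym: "{a, b} \<in> edges N \<Longrightarrow> x \<in> actions N \<Longrightarrow> y \<in> actions N
           \<Longrightarrow> inter N a b x y = inter N b a y x"

definition neighbors :: "'v net \<Rightarrow> 'v \<Rightarrow> 'v set" where
  "neighbors N u = {v. {u, v} \<in> edges N}"

definition assignments :: "'v net \<Rightarrow> ('v \<Rightarrow> nat) set" where
  "assignments N = (verts N \<rightarrow>\<^sub>E actions N)"

(* The value does not depend on which endpoint is called a; see edge_value_eq. *)

definition edge_value :: "'v net \<Rightarrow> ('v \<Rightarrow> nat) \<Rightarrow> 'v set \<Rightarrow> ereal" where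
  "edge_value N z e = (THE r. \<exists>a b. e = {a, b} \<and> r = inter N a b (z a) (z b))"

definition objective :: "'v net \<Rightarrow> ('v \<Rightarrow> nat) \<Rightarrow> ereal" where
  "objective N z = (\<Sum>e\<in>edges N. edge_value N z e) + (\<Sum>v\<in>verts N. pot N v (z v))"

definition max_value :: "'v net \<Rightarrow> 'v \<Rightarrow> nat \<Rightarrow> ereal" where
  "max_value N v x = Max (objective N ` {z \<in> assignments N. z v = x})"

definition cavity :: "'v net \<Rightarrow> 'v \<Rightarrow> nat \<Rightarrow> ereal" where
  "cavity N v x = max_value N v x - max_value N v 0"

definition edge_max :: "'v net \<Rightarrow> 'v \<Rightarrow> 'v \<Rightarrow> nat \<Rightarrow> (nat \<Rightarrow> ereal) \<Rightarrow> ereal" where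
  "edge_max N u v x B = (MAX y\<in>actions N. inter N u v x y + B y)"

definition partial_cavity :: "'v net \<Rightarrow> 'v \<Rightarrow> 'v \<Rightarrow> nat \<Rightarrow> (nat \<Rightarrow> ereal) \<Rightarrow> ereal" where
  "partial_cavity N u v x B = edge_max N u v x B - edge_max N u v 0 B"

(* vs enumerates the neighbors of u and j counts from 0: the neighbors before position j
   see action x at u, those after position j see action 0. *)

definition modified_net :: "'v net \<Rightarrow> 'v \<Rightarrow> 'v list \<Rightarrow> nat \<Rightarrow> nat \<Rightarrow> 'v net" where
  "modified_net N u vs j x = N\<lparr>
     verts := verts N - {u},
     edges := {e \<in> edges N. e \<subseteq> verts N - {u}},
     pot := (\<lambda>v y.
       if v \<in> set (take j vs) then pot N v y + inter N u v x y
       else if v \<in> set (drop (Suc j) vs) then pot N v y + inter N u v 0 y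
       else pot N v y)\<rparr>"

(* In ereal the difference of two equal infinities is totalized to infinity.  The following
   predicates express that a - b, respectively the sum of the members of S, is not of the
   undefined form. *)

definition diff_defined :: "ereal \<Rightarrow> ereal \<Rightarrow> bool" where
  "diff_defined a b \<longleftrightarrow> \<not> (a = -\<infinity> \<and> b = -\<infinity>)"

definition sum_defined :: "ereal set \<Rightarrow> bool" where
  "sum_defined S \<longleftrightarrow> \<not> (\<infinity> \<in> S \<and> -\<infinity> \<in> S)"

definition cavity_defined :: "'v net \<Rightarrow> 'v \<Rightarrow> nat \<Rightarrow> bool" where
  "cavity_defined N v x \<longleftrightarrow> diff_defined (max_value N v x) (max_value N v 0)"

definition partial_cavity_defined ::
    "'v net \<Rightarrow> 'v \<Rightarrow> 'v \<Rightarrow> nat \<Rightarrow> (nat \<Rightarrow> ereal) \<Rightarrow> bool" where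
  "partial_cavity_defined N u v x B \<longleftrightarrow>
     diff_defined (edge_max N u v x B) (edge_max N u v 0 B)"

context decision_network
begin

lemma edge_value_eq:
  assumes "{a, b} \<in> edges N" and "z \<in> assignments N"
  shows "edge_value N z {a, b} = inter N a b (z a) (z b)"
proof -
  have "a \<in> verts N" "b \<in> verts N"
    using edges_simple[OF assms(1)] by auto
  then have "z a \<in> actions N" "z b \<in> actions N"
    using assms(2) by (auto simp: assignments_def)
  then have "inter N a b (z a) (z b) = inter N b a (z b) (z a)"
    using inter_sym assms(1) by blast
  then show ?thesis
    unfolding edge_value_def by (intro the_equality) (auto simp: doubleton_eq_iff)
qed

lemma decision_network_modified_net:
  assumes "set vs = neighbors N u" and "x \<in> actions N"
  shows "decision_network (modified_net N u vs j x)"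
proof -
  have z: "0 \<in> actions N"
    using actions_nonempty by (simp add: actions_def)
  have acts: "actions (modified_net N u vs j x) = actions N"
    by (simp add: actions_def modified_net_def)
  have nb: "{u, v} \<in> edges N" if "v \<in> set (take j vs) \<or> v \<in> set (drop (Suc j) vs)" for v
    using that assms(1) by (auto simp: neighbors_def dest: in_set_takeD in_set_dropD)
  have "pot (modified_net N u vs j x) v y \<noteq> \<infinity>" if "v \<in> verts N" "y \<in> actions N" for v y
    using pot_not_PInf[OF that] inter_not_PInf[OF nb[of v] assms(2) that(2)]
      inter_not_PInf[OF nb[of v] z that(2)]
    by (auto simp: modified_net_def)
  then show ?thesis
    using finite_verts edges_simple actions_nonempty inter_not_PInf inter_sym
    by unfold_locales (auto simp: acts, auto simp: modified_net_def)
qed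

end

end

theory Submission
  imports Defs
begin

text \<open>
  Delete \<open>u\<close> and let every neighbor \<open>v\<close> of \<open>u\<close> respond to an action \<open>s v\<close> that \<open>u\<close> is
  claimed to play, where different neighbors may be told different actions. Write
  \<open>response_max s\<close> for the best value that the remaining vertices can reach, the interactions
  with \<open>u\<close> included. If all neighbors are told the same action \<open>a\<close>, this is the value of the
  original network with \<open>u\<close> playing \<open>a\<close>, except for the potential of \<open>u\<close> itself
  (\<open>max_value_root\<close>). So the cavity at \<open>u\<close> compares the claim ``everyone is told \<open>x\<close>'' with
  the claim ``everyone is told \<open>0\<close>''.

  Pass from the second claim to the first by changing what the neighbors are told, one neighbor
  at a time in the order of the list \<open>vs\<close>. This gives values \<open>M 0, ..., M d\<close>. In step \<open>j\<close> only
  the neighbor \<open>vs ! j\<close> hears something new, and the claims to all others are exactly those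
  absorbed into the potentials of the modified network. Maximizing first over the action of
  \<open>vs ! j\<close> and then over everything else expresses both \<open>M (Suc j)\<close> and \<open>M j\<close> through the
  max-values of that modified network at \<open>vs ! j\<close> (\<open>edge_max_modified\<close>). Replacing the
  max-values by cavities shifts both by the same constant, so \<open>M (Suc j) - M j\<close> is the
  partial cavity (\<open>partial_cavity_eq_diff\<close>), and the sum of the partial cavities telescopes.

  Values \<open>-\<infinity>\<close> need care in two places. The constant of the shift is finite because the
  cavity of action \<open>0\<close> at \<open>vs ! j\<close> is well defined. An intermediate value \<open>M j = -\<infinity>\<close> would
  contribute \<open>-\<infinity>\<close> in step \<open>j - 1\<close> and \<open>\<infinity>\<close> in step \<open>j\<close>, and the sum would not be well
  defined; so only the two ends of the chain can be \<open>-\<infinity>\<close>, and they do not obstruct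
  telescoping.
\<close>

section \<open>Maxima and differences of extended reals\<close>

lemma Max_add_const_ereal:
  fixes f :: "'a \<Rightarrow> ereal"
  assumes "finite A" and "A \<noteq> {}"
  shows "Max ((\<lambda>z. c + f z) ` A) = c + Max (f ` A)"
proof -
  have "mono (\<lambda>t. c + t)"
    by (intro monoI add_left_mono)
  then have "c + Max (f ` A) = Max ((\<lambda>t. c + t) ` f ` A)"
    using assms by (intro mono_Max_commute) auto
  then show ?thesis
    by (simp add: image_image)
qed

text \<open>A summand that depends on \<open>z\<close> only through \<open>g z\<close> is constant on each fiber of \<open>g\<close>, so it
  moves out of the maximum over that fiber.\<close>

lemma Max_fiberwise:
  fixes f :: "'a \<Rightarrow> ereal" and c :: "'b \<Rightarrow> ereal"
  assumes A: "finite A" and Y: "finite Y" "Y \<noteq> {}" and g: "g ` A \<subseteq> Y"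
    and fib: "\<And>y. y \<in> Y \<Longrightarrow> {z \<in> A. g z = y} \<noteq> {}"
  shows "Max ((\<lambda>z. f z + c (g z)) ` A) = (MAX y\<in>Y. c y + Max (f ` {z \<in> A. g z = y}))"
proof -
  have inner: "c y + Max (f ` {z \<in> A. g z = y}) = Max ((\<lambda>z. f z + c (g z)) ` {z \<in> A. g z = y})"
    if "y \<in> Y" for y
  proof -
    have "c y + Max (f ` {z \<in> A. g z = y}) = Max ((\<lambda>z. c y + f z) ` {z \<in> A. g z = y})"
      using A fib[OF that] by (intro Max_add_const_ereal[symmetric]) auto
    also have "(\<lambda>z. c y + f z) ` {z \<in> A. g z = y} = (\<lambda>z. f z + c (g z)) ` {z \<in> A. g z = y}"
      by (rule image_cong) (auto simp: add.commute)
    finally show ?thesis .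
  qed
  obtain y0 where y0: "y0 \<in> Y" using Y by auto
  have A_ne: "A \<noteq> {}" using fib[OF y0] by auto
  have "Max ((\<lambda>z. f z + c (g z)) ` A)
      = (MAX y\<in>Y. Max ((\<lambda>z. f z + c (g z)) ` {z \<in> A. g z = y}))" (is "?L = ?R")
  proof (rule antisym)
    show "?L \<le> ?R"
    proof (rule Max.boundedI)
      fix t assume "t \<in> (\<lambda>z. f z + c (g z)) ` A"
      then obtain z where z: "z \<in> A" "t = f z + c (g z)" by auto
      have "t \<le> Max ((\<lambda>z'. f z' + c (g z')) ` {z' \<in> A. g z' = g z})"
        using z A by (intro Max_ge) auto
      also have "\<dots> \<le> ?R"
        using z g Y by (intro Max_ge) auto
      finally show "t \<le> ?R" .
    qed (use A A_ne in auto)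
    show "?R \<le> ?L"
    proof (rule Max.boundedI)
      fix t assume "t \<in> (\<lambda>y. Max ((\<lambda>z. f z + c (g z)) ` {z \<in> A. g z = y})) ` Y"
      then obtain y where y: "y \<in> Y" "t = Max ((\<lambda>z. f z + c (g z)) ` {z \<in> A. g z = y})"
        by auto
      show "t \<le> ?L"
        unfolding y(2) using A fib[OF y(1)] by (intro Max_mono) auto
    qed (use Y in auto)
  qed
  also have "?R = (MAX y\<in>Y. c y + Max (f ` {z \<in> A. g z = y}))"
    using inner by (intro arg_cong[where f = Max] image_cong) auto
  finally show ?thesis .
qed

text \<open>A term \<open>M i = -\<infinity>\<close> with \<open>0 < i < d\<close> would leave \<open>-\<infinity> + \<infinity>\<close> in the sum, whereas
  \<open>-\<infinity>\<close> at an end makes both sides the same infinity. For \<open>d = 0\<close> the right-hand side is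
  \<open>M 0 - M 0\<close>, which is \<open>0\<close> only for finite \<open>M 0\<close>.\<close>

lemma sum_telescope_ereal:
  fixes M :: "nat \<Rightarrow> ereal"
  assumes "0 < d" and "\<And>i. M i \<noteq> \<infinity>"
    and "\<And>i. 0 < i \<Longrightarrow> i < d \<Longrightarrow> M i \<noteq> -\<infinity>"
  shows "(\<Sum>i<d. M (Suc i) - M i) = M d - M 0"
  using assms(1,3)
proof (induction d rule: nat_induct_non_zero)
  case 1
  then show ?case by simp
next
  case (Suc d)
  then have "(\<Sum>i<Suc d. M (Suc i) - M i) = (M d - M 0) + (M (Suc d) - M d)"
    by simp
  also have "\<dots> = M (Suc d) - M 0"
    using Suc.prems[of d] Suc.hyps assms(2)[of 0] assms(2)[of d] assms(2)[of "Suc d"]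
    by (cases "M 0"; cases "M d"; cases "M (Suc d)") auto
  finally show ?case .
qed

section \<open>Responses to the claimed actions of a deleted vertex\<close>

definition residual_assignments :: "'v net \<Rightarrow> 'v \<Rightarrow> ('v \<Rightarrow> nat) set" where
  "residual_assignments N u = (verts N - {u} \<rightarrow>\<^sub>E actions N)"

text \<open>Here \<open>s v\<close> is the action that the neighbor \<open>v\<close> is told \<open>u\<close> plays.\<close>

definition response_value :: "'v net \<Rightarrow> 'v \<Rightarrow> ('v \<Rightarrow> nat) \<Rightarrow> ('v \<Rightarrow> nat) \<Rightarrow> ereal" where
  "response_value N u s w =
     (\<Sum>e\<in>{e \<in> edges N. e \<subseteq> verts N - {u}}. edge_value N w e)
     + (\<Sum>v\<in>verts N - {u}. pot N v (w v))
     + (\<Sum>v\<in>neighbors N u. inter N u v (s v) (w v))"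

definition response_max :: "'v net \<Rightarrow> 'v \<Rightarrow> ('v \<Rightarrow> nat) \<Rightarrow> ereal" where
  "response_max N u s = Max (response_value N u s ` residual_assignments N u)"

lemma response_max_cong:
  assumes "\<And>v. v \<in> neighbors N u \<Longrightarrow> s v = s' v"
  shows "response_max N u s = response_max N u s'"
  using assms by (simp add: response_max_def response_value_def cong: sum.cong)

text \<open>The claims after \<open>j\<close> neighbors have switched from \<open>0\<close> to \<open>x\<close>.\<close>

definition partial_switch :: "'v list \<Rightarrow> nat \<Rightarrow> nat \<Rightarrow> 'v \<Rightarrow> nat" where
  "partial_switch vs x j v = (if v \<in> set (take j vs) then x else 0)"

lemma partial_switch_Suc:
  assumes "j < length vs"
  shows "partial_switch vs x (Suc j) = (partial_switch vs x j)(vs ! j := x)"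
  using assms by (auto simp: partial_switch_def take_Suc_conv_app_nth)

lemma partial_switch_unswitched:
  assumes "distinct vs" and "j < length vs"
  shows "partial_switch vs x j = (partial_switch vs x j)(vs ! j := 0)"
proof -
  have "vs ! j \<notin> set (take j vs)"
    using assms by (auto simp: in_set_conv_nth nth_eq_iff_index_eq)
  then show ?thesis
    by (auto simp: partial_switch_def)
qed

lemma edge_value_cong:
  assumes "\<And>v. v \<in> e \<Longrightarrow> z v = w v"
  shows "edge_value N z e = edge_value N w e"
proof -
  have "(\<exists>a b. e = {a, b} \<and> r = inter N a b (z a) (z b))
      \<longleftrightarrow> (\<exists>a b. e = {a, b} \<and> r = inter N a b (w a) (w b))" for r
    using assms by (metis insertCI)
  then show ?thesis
    by (simp add: edge_value_def)
qed

context decision_network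
begin

lemma finite_actions: "finite (actions N)"
  by (simp add: actions_def)

lemma zero_action: "0 \<in> actions N"
  using actions_nonempty by (simp add: actions_def)

lemma finite_edges: "finite (edges N)"
  using finite_verts edges_simple by (auto intro: finite_subset[of _ "Pow (verts N)"])

lemma neighbors_subset: "neighbors N u \<subseteq> verts N - {u}"
proof
  fix v assume "v \<in> neighbors N u"
  then have "{u, v} \<subseteq> verts N" "card {u, v} = 2"
    using edges_simple unfolding neighbors_def by blast+
  then show "v \<in> verts N - {u}"
    by (cases "v = u") auto
qed

lemma finite_neighbors: "finite (neighbors N u)"
  using neighbors_subset finite_verts by (rule finite_subset[OF _ finite_Diff])

lemma finite_residual_assignments: "finite (residual_assignments N u)"
  by (simp add: residual_assignments_def finite_PiE finite_verts finite_actions)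

lemma residual_assignment_exists:
  assumes "v \<in> verts N - {u}" and "y \<in> actions N"
  shows "{w \<in> residual_assignments N u. w v = y} \<noteq> {}"
proof -
  have "(\<lambda>t\<in>verts N - {u}. y) \<in> {w \<in> residual_assignments N u. w v = y}"
    using assms by (auto simp: residual_assignments_def)
  then show ?thesis by blast
qed

lemma residual_assignments_nonempty: "residual_assignments N u \<noteq> {}"
  using zero_action by (auto simp: residual_assignments_def PiE_eq_empty_iff)

lemma edges_split:
  "edges N = {e \<in> edges N. e \<subseteq> verts N - {u}} \<union> (\<lambda>v. {u, v}) ` neighbors N u"
proof -
  have "e \<in> (\<lambda>v. {u, v}) ` neighbors N u" if "e \<in> edges N" "u \<in> e" for e
  proof -
    have "card e = 2" using edges_simple that by blast
    then obtain v where "e = {u, v}"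
      using \<open>u \<in> e\<close> by (auto simp: card_2_iff)
    then show ?thesis using that by (auto simp: neighbors_def)
  qed
  then show ?thesis
    using edges_simple by (auto simp: neighbors_def)
qed

lemma assignments_fiber:
  assumes "u \<in> verts N" and "a \<in> actions N"
  shows "{z \<in> assignments N. z u = a} = (\<lambda>w. w(u := a)) ` residual_assignments N u"
proof (intro equalityI subsetI)
  fix z assume z: "z \<in> {z \<in> assignments N. z u = a}"
  have "z(u := undefined) \<in> residual_assignments N u"
    unfolding residual_assignments_def
  proof (rule PiE_I)
    fix v assume "v \<in> verts N - {u}"
    then show "(z(u := undefined)) v \<in> actions N"
      using z PiE_mem[of z "verts N" "\<lambda>_. actions N" v] by (simp add: assignments_def)
  next
    fix v assume "v \<notin> verts N - {u}"
    then show "(z(u := undefined)) v = undefined"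
      using z PiE_arb[of z "verts N" "\<lambda>_. actions N" v] by (auto simp: assignments_def)
  qed
  moreover have "z = (z(u := undefined))(u := a)"
    using z by (auto simp: fun_eq_iff)
  ultimately show "z \<in> (\<lambda>w. w(u := a)) ` residual_assignments N u"
    using image_eqI[of z "\<lambda>w. w(u := a)" "z(u := undefined)"] by blast
next
  fix z assume "z \<in> (\<lambda>w. w(u := a)) ` residual_assignments N u"
  then obtain w where w: "w \<in> residual_assignments N u" "z = w(u := a)"
    by blast
  have "z \<in> assignments N"
    unfolding assignments_def
  proof (rule PiE_I)
    fix v assume "v \<in> verts N"
    then show "z v \<in> actions N"
      using w assms(2) PiE_mem[of w "verts N - {u}" "\<lambda>_. actions N" v]
      by (simp add: residual_assignments_def)
  next
    fix v assume "v \<notin> verts N"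
    then show "z v = undefined"
      using w assms(1) PiE_arb[of w "verts N - {u}" "\<lambda>_. actions N" v]
      by (auto simp: residual_assignments_def)
  qed
  then show "z \<in> {z \<in> assignments N. z u = a}"
    using w by simp
qed

lemma objective_root:
  assumes u: "u \<in> verts N" and a: "a \<in> actions N" and w: "w \<in> residual_assignments N u"
  shows "objective N (w(u := a)) = pot N u a + response_value N u (\<lambda>_. a) w"
proof -
  let ?z = "w(u := a)"
  let ?R = "{e \<in> edges N. e \<subseteq> verts N - {u}}"
  have z: "?z \<in> assignments N"
    using assignments_fiber[OF u a] w by auto
  have inj: "inj_on (\<lambda>v. {u, v}) (neighbors N u)"
    by (auto simp: inj_on_def doubleton_eq_iff)
  have "(\<Sum>e\<in>edges N. edge_value N ?z e)
      = (\<Sum>e\<in>?R. edge_value N ?z e) + (\<Sum>e\<in>(\<lambda>v. {u, v}) ` neighbors N u. edge_value N ?z e)"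
    by (subst edges_split[of u], rule sum.union_disjoint)
      (auto simp: finite_edges finite_neighbors)
  also have "(\<Sum>e\<in>?R. edge_value N ?z e) = (\<Sum>e\<in>?R. edge_value N w e)"
    by (intro sum.cong edge_value_cong) auto
  also have "(\<Sum>e\<in>(\<lambda>v. {u, v}) ` neighbors N u. edge_value N ?z e)
      = (\<Sum>v\<in>neighbors N u. edge_value N ?z {u, v})"
    using inj by (simp add: sum.reindex)
  also have "\<dots> = (\<Sum>v\<in>neighbors N u. inter N u v a (w v))"
  proof (rule sum.cong)
    fix v assume v: "v \<in> neighbors N u"
    then have "v \<noteq> u" using neighbors_subset by auto
    then show "edge_value N ?z {u, v} = inter N u v a (w v)"
      using edge_value_eq[OF _ z, of u v] v by (simp add: neighbors_def)
  qed simp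
  finally have E: "(\<Sum>e\<in>edges N. edge_value N ?z e)
      = (\<Sum>e\<in>?R. edge_value N w e) + (\<Sum>v\<in>neighbors N u. inter N u v a (w v))" .
  have "(\<Sum>v\<in>verts N. pot N v (?z v))
      = pot N u a + (\<Sum>v\<in>verts N - {u}. pot N v (?z v))"
    using sum.remove[OF finite_verts u, of "\<lambda>v. pot N v (?z v)"] by simp
  also have "(\<Sum>v\<in>verts N - {u}. pot N v (?z v)) = (\<Sum>v\<in>verts N - {u}. pot N v (w v))"
    by (intro sum.cong) auto
  finally have P: "(\<Sum>v\<in>verts N. pot N v (?z v))
      = pot N u a + (\<Sum>v\<in>verts N - {u}. pot N v (w v))" .
  show ?thesis
    unfolding objective_def response_value_def E P
    by (simp only: add.assoc add.commute add.left_commute)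
qed

lemma max_value_root:
  assumes "u \<in> verts N" and "a \<in> actions N"
  shows "max_value N u a = pot N u a + response_max N u (\<lambda>_. a)"
proof -
  have "max_value N u a
      = Max ((\<lambda>w. pot N u a + response_value N u (\<lambda>_. a) w) ` residual_assignments N u)"
    unfolding max_value_def assignments_fiber[OF assms] image_image
    by (intro arg_cong[where f = Max] image_cong refl objective_root[OF assms])
  also have "\<dots> = pot N u a + response_max N u (\<lambda>_. a)"
    unfolding response_max_def
    by (rule Max_add_const_ereal[OF finite_residual_assignments
          residual_assignments_nonempty])
  finally show ?thesis .
qed

lemma response_max_not_PInf:
  assumes "\<And>v. v \<in> neighbors N u \<Longrightarrow> s v \<in> actions N"
  shows "response_max N u s \<noteq> \<infinity>"
proof -
  have "response_max N u s \<in> response_value N u s ` residual_assignments N u"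
    unfolding response_max_def
    by (intro Max_in) (auto simp: finite_residual_assignments residual_assignments_nonempty)
  then obtain w where w: "w \<in> residual_assignments N u"
    and eq: "response_max N u s = response_value N u s w"
    by auto
  have act: "w v \<in> actions N" if "v \<in> verts N - {u}" for v
    using w that by (auto simp: residual_assignments_def)
  have "edge_value N w e \<noteq> \<infinity>" if e: "e \<in> edges N" "e \<subseteq> verts N - {u}" for e
  proof -
    obtain b c where bc: "e = {b, c}"
      using edges_simple[OF e(1)] by (auto simp: card_2_iff)
    \<comment> \<open>The value of an edge is read off a full assignment, so \<open>u\<close> gets the dummy action \<open>0\<close>.\<close>
    define z where "z = (\<lambda>v\<in>verts N. if v = u then 0 else w v)"
    have z: "z \<in> assignments N"
      using act zero_action by (auto simp: z_def assignments_def)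
    have "edge_value N w e = edge_value N z e"
      using e by (intro edge_value_cong) (auto simp: z_def)
    also have "\<dots> = inter N b c (z b) (z c)"
      using edge_value_eq[OF _ z] e bc by simp
    finally show ?thesis
      using inter_not_PInf[of b c "z b" "z c"] e z bc by (auto simp: assignments_def)
  qed
  moreover have "pot N v (w v) \<noteq> \<infinity>" if "v \<in> verts N - {u}" for v
    using pot_not_PInf act that by auto
  moreover have "inter N u v (s v) (w v) \<noteq> \<infinity>" if "v \<in> neighbors N u" for v
    using inter_not_PInf[of u v] assms[OF that] act[of v] that neighbors_subset[of u]
    by (auto simp: neighbors_def)
  ultimately show ?thesis
    unfolding eq response_value_def by (auto simp: sum_Pinfty)
qed

section \<open>One step of the chain\<close>

text \<open>The potentials of the modified network carry the interactions of \<open>u\<close> with all its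
  neighbors but \<open>vs ! j\<close>; whatever action \<open>a\<close> that neighbor is told, its interaction with \<open>u\<close>
  supplies the missing term.\<close>

lemma objective_modified:
  assumes vs: "distinct vs" "set vs = neighbors N u" and j: "j < length vs"
  shows "objective (modified_net N u vs j x) w + inter N u (vs ! j) a (w (vs ! j))
    = response_value N u ((partial_switch vs x j)(vs ! j := a)) w"
proof -
  let ?s = "(partial_switch vs x j)(vs ! j := a)"
  let ?M = "modified_net N u vs j x"
  let ?v = "vs ! j"
  let ?g = "\<lambda>v. if v \<in> neighbors N u - {?v} then inter N u v (?s v) (w v) else 0"
  have v: "?v \<in> neighbors N u"
    using nth_mem[OF j] vs(2) by simp
  have split: "vs = take j vs @ ?v # drop (Suc j) vs"
    using j by (rule id_take_nth_drop)
  have parts: "neighbors N u - {?v} = set (take j vs) \<union> set (drop (Suc j) vs)"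
      "?v \<notin> set (take j vs)" "?v \<notin> set (drop (Suc j) vs)"
      "set (take j vs) \<inter> set (drop (Suc j) vs) = {}"
  proof -
    have "distinct (take j vs @ ?v # drop (Suc j) vs)"
      using vs(1) by (rule subst[OF split])
    then show new: "?v \<notin> set (take j vs)" "?v \<notin> set (drop (Suc j) vs)"
        "set (take j vs) \<inter> set (drop (Suc j) vs) = {}"
      by auto
    have "set vs = set (take j vs @ ?v # drop (Suc j) vs)"
      by (rule arg_cong[OF split])
    then show "neighbors N u - {?v} = set (take j vs) \<union> set (drop (Suc j) vs)"
      using new vs(2) by auto
  qed
  have pot: "pot ?M v (w v) = pot N v (w v) + ?g v" for v
    using parts by (auto simp: modified_net_def partial_switch_def)
  have "(\<Sum>v\<in>verts N - {u}. ?g v) = (\<Sum>v\<in>neighbors N u - {?v}. inter N u v (?s v) (w v))"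
    using neighbors_subset[of u] finite_verts by (intro sum.mono_neutral_cong_right) auto
  then have "(\<Sum>v\<in>verts N - {u}. ?g v) + inter N u ?v a (w ?v)
      = (\<Sum>v\<in>neighbors N u. inter N u v (?s v) (w v))"
    using sum.remove[OF finite_neighbors v, of "\<lambda>v. inter N u v (?s v) (w v)"]
    by (simp add: add.commute)
  moreover have "objective ?M w = (\<Sum>e\<in>{e \<in> edges N. e \<subseteq> verts N - {u}}. edge_value N w e)
      + ((\<Sum>v\<in>verts N - {u}. pot N v (w v)) + (\<Sum>v\<in>verts N - {u}. ?g v))"
  proof -
    have "edge_value ?M w e = edge_value N w e" for e
      by (simp add: edge_value_def modified_net_def)
    moreover have "verts ?M = verts N - {u}" "edges ?M = {e \<in> edges N. e \<subseteq> verts N - {u}}"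
      by (simp_all add: modified_net_def)
    ultimately show ?thesis
      unfolding objective_def pot sum.distrib by simp
  qed
  ultimately show ?thesis
    unfolding response_value_def by (simp add: add.assoc)
qed

text \<open>Max-values in place of cavities: the best response is found by first fixing the action
  of \<open>vs ! j\<close>.\<close>

lemma edge_max_modified:
  assumes vs: "distinct vs" "set vs = neighbors N u" and j: "j < length vs"
  shows "edge_max N u (vs ! j) a (max_value (modified_net N u vs j x) (vs ! j))
    = response_max N u ((partial_switch vs x j)(vs ! j := a))"
proof -
  let ?M = "modified_net N u vs j x"
  have v: "vs ! j \<in> verts N - {u}"
    using vs j neighbors_subset nth_mem by blast
  have asg: "assignments ?M = residual_assignments N u"
    by (simp add: assignments_def residual_assignments_def actions_def modified_net_def)
  have resp: "(\<lambda>w. objective ?M w + inter N u (vs ! j) a (w (vs ! j)))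
      = response_value N u ((partial_switch vs x j)(vs ! j := a))"
    using objective_modified[OF vs j] by blast
  have "Max ((\<lambda>w. objective ?M w + inter N u (vs ! j) a (w (vs ! j)))
        ` residual_assignments N u)
      = (MAX y\<in>actions N. inter N u (vs ! j) a y
          + Max (objective ?M ` {w \<in> residual_assignments N u. w (vs ! j) = y}))"
    using v zero_action residual_assignment_exists[OF v] finite_actions
    by (intro Max_fiberwise[OF finite_residual_assignments])
      (auto simp: residual_assignments_def)
  then show ?thesis
    unfolding edge_max_def max_value_def response_max_def asg resp by (rule sym)
qed

lemma edge_max_shift:
  assumes "\<bar>c\<bar> \<noteq> \<infinity>"
  shows "edge_max N u v a (\<lambda>y. J y - c) = edge_max N u v a J - c"
proof -
  have shift: "t - c = - c + t" for t
    using assms by (cases c; cases t) auto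
  have "(\<lambda>y. inter N u v a y + (J y - c)) = (\<lambda>y. - c + (inter N u v a y + J y))"
    unfolding shift by (auto simp: ac_simps)
  then have "edge_max N u v a (\<lambda>y. J y - c)
      = (MAX y\<in>actions N. - c + (inter N u v a y + J y))"
    unfolding edge_max_def by (rule arg_cong[where f = "\<lambda>f. Max (f ` actions N)"])
  also have "\<dots> = - c + edge_max N u v a J"
    unfolding edge_max_def
    using finite_actions zero_action by (intro Max_add_const_ereal) auto
  finally show ?thesis
    by (simp only: shift)
qed

text \<open>That the cavity of action \<open>0\<close> is well defined means that the max-value of action \<open>0\<close>
  is not \<open>-\<infinity>\<close>. This value is the constant by which cavities and max-values differ, and it
  drops out of the partial cavity.\<close>

lemma partial_cavity_eq_diff:
  fixes vs :: "'v list"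
  assumes vs: "distinct vs" "set vs = neighbors N u" and j: "j < length vs"
    and x: "x \<in> actions N"
    and cav: "cavity_defined (modified_net N u vs j x) (vs ! j) 0"
    and def: "partial_cavity_defined N u (vs ! j) x
      (cavity (modified_net N u vs j x) (vs ! j))"
  shows "partial_cavity N u (vs ! j) x (cavity (modified_net N u vs j x) (vs ! j))
      = response_max N u (partial_switch vs x (Suc j))
        - response_max N u (partial_switch vs x j)"
    and "diff_defined (response_max N u (partial_switch vs x (Suc j)))
      (response_max N u (partial_switch vs x j))"
proof -
  let ?M = "modified_net N u vs j x"
  define c where "c = max_value ?M (vs ! j) 0"
  have v: "vs ! j \<in> verts N - {u}"
    using vs j neighbors_subset nth_mem by blast
  interpret M: decision_network ?M
    using decision_network_modified_net[OF vs(2) x] .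
  have "c \<noteq> -\<infinity>"
    using cav by (simp add: cavity_defined_def diff_defined_def c_def)
  moreover have "c \<noteq> \<infinity>"
  proof -
    have vM: "vs ! j \<in> verts ?M"
      using v by (simp add: modified_net_def)
    show ?thesis
      unfolding c_def M.max_value_root[OF vM M.zero_action]
      using M.pot_not_PInf[OF vM M.zero_action] M.zero_action
        M.response_max_not_PInf[of "vs ! j" "\<lambda>_. 0"]
      by auto
  qed
  ultimately have c: "\<bar>c\<bar> \<noteq> \<infinity>"
    by auto
  have "cavity ?M (vs ! j) = (\<lambda>y. max_value ?M (vs ! j) y - c)"
    by (auto simp: cavity_def c_def)
  then have em: "edge_max N u (vs ! j) a (cavity ?M (vs ! j))
      = response_max N u ((partial_switch vs x j)(vs ! j := a)) - c" for a
    by (simp add: edge_max_shift[OF c] edge_max_modified[OF vs j])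
  note em_x = em[of x, folded partial_switch_Suc[OF j]]
    and em_0 = em[of 0, folded partial_switch_unswitched[OF vs(1) j]]
  show "diff_defined (response_max N u (partial_switch vs x (Suc j)))
      (response_max N u (partial_switch vs x j))"
    using def c unfolding partial_cavity_defined_def em_x em_0 diff_defined_def by auto
  have "(s - c) - (t - c) = s - t" for s t :: ereal
    using c by (cases c; cases s; cases t) auto
  then show "partial_cavity N u (vs ! j) x (cavity ?M (vs ! j))
      = response_max N u (partial_switch vs x (Suc j))
        - response_max N u (partial_switch vs x j)"
    unfolding partial_cavity_def em_x em_0 .
qed

end

section \<open>The cavity recursion\<close>

theorem theorem6:
  fixes N :: "'v net" and u :: 'v and vs :: "'v list" and x :: nat
  assumes "decision_network N"
    and "u \<in> verts N"
    and "distinct vs" and "set vs = neighbors N u"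
    and "x \<in> actions N"
    and "cavity_defined N u x"
    and "diff_defined (pot N u x) (pot N u 0)"
    and "\<And>j y. j < length vs \<Longrightarrow> y \<in> actions N \<Longrightarrow>
           cavity_defined (modified_net N u vs j x) (vs ! j) y"
    and "\<And>j. j < length vs \<Longrightarrow>
           partial_cavity_defined N u (vs ! j) x (cavity (modified_net N u vs j x) (vs ! j))"
    and "sum_defined (insert (pot N u x - pot N u 0)
           ((\<lambda>j. partial_cavity N u (vs ! j) x (cavity (modified_net N u vs j x) (vs ! j)))
              ` {..<length vs}))"
  shows "cavity N u x = pot N u x - pot N u 0
           + (\<Sum>j<length vs.
                partial_cavity N u (vs ! j) x (cavity (modified_net N u vs j x) (vs ! j)))"
proof -
  interpret decision_network N by fact
  note vs = assms(3,4)
  define M where "M j = response_max N u (partial_switch vs x j)" for j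
  define p where "p = pot N u x"
  define q where "q = pot N u 0"
  let ?d = "length vs"
  let ?\<mu> = "\<lambda>j. partial_cavity N u (vs ! j) x (cavity (modified_net N u vs j x) (vs ! j))"
  have M_fin: "M j \<noteq> \<infinity>" for j
    unfolding M_def using assms(5) zero_action
    by (intro response_max_not_PInf) (auto simp: partial_switch_def)
  have pq_fin: "p \<noteq> \<infinity>" "q \<noteq> \<infinity>"
    using assms(2,5) zero_action pot_not_PInf by (auto simp: p_def q_def)
  have mu: "?\<mu> j = M (Suc j) - M j" "diff_defined (M (Suc j)) (M j)" if "j < ?d" for j
    using partial_cavity_eq_diff[OF vs that assms(5) assms(8)[OF that zero_action]
        assms(9)[OF that]]
    by (simp_all add: M_def)
  have "response_max N u (\<lambda>_. x) = M ?d"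
    unfolding M_def using vs by (intro response_max_cong) (simp add: partial_switch_def)
  then have Jx: "max_value N u x = p + M ?d"
    using max_value_root[OF assms(2,5)] by (simp add: p_def)
  have "response_max N u (\<lambda>_. 0) = M 0"
    unfolding M_def by (intro response_max_cong) (simp add: partial_switch_def)
  then have J0: "max_value N u 0 = q + M 0"
    using max_value_root[OF assms(2) zero_action] by (simp add: q_def)
  have sum_mu: "(\<Sum>j<?d. ?\<mu> j) = M ?d - M 0"
  proof (cases "?d = 0")
    case True
    \<comment> \<open>Both max-values at \<open>u\<close> contain the summand \<open>M 0\<close>. If it were \<open>-\<infinity>\<close>, both would be
      \<open>-\<infinity>\<close>, and the cavity at \<open>u\<close> would not be well defined.\<close>
    then have "M 0 \<noteq> -\<infinity>"
      using assms(6) pq_fin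
      by (auto simp: cavity_defined_def diff_defined_def Jx J0 plus_ereal.simps)
    then show ?thesis
      using True M_fin[of 0] by (cases "M 0") auto
  next
    case False
    \<comment> \<open>Otherwise step \<open>i - 1\<close> descends to \<open>-\<infinity>\<close> and step \<open>i\<close> climbs back from it.\<close>
    have interior: "M i \<noteq> -\<infinity>" if i: "0 < i" "i < ?d" for i
    proof
      assume Mi: "M i = -\<infinity>"
      obtain k where k: "i = Suc k" using i by (cases i) auto
      have "?\<mu> k = -\<infinity>"
        using mu[of k] M_fin[of k] i k Mi
        by (cases "M k") (auto simp: diff_defined_def)
      moreover have "?\<mu> i = \<infinity>"
        using mu[OF i(2)] M_fin[of "Suc i"] Mi
        by (cases "M (Suc i)") (auto simp: diff_defined_def)
      moreover have "k < ?d" using i k by simp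
      ultimately have "\<infinity> \<in> ?\<mu> ` {..<?d}" "-\<infinity> \<in> ?\<mu> ` {..<?d}"
        using i(2) imageI[of i "{..<?d}" ?\<mu>] imageI[of k "{..<?d}" ?\<mu>] by simp_all
      then show False
        using assms(10) by (auto simp: sum_defined_def)
    qed
    have "(\<Sum>j<?d. ?\<mu> j) = (\<Sum>j<?d. M (Suc j) - M j)"
      using mu(1) by (intro sum.cong) auto
    also have "\<dots> = M ?d - M 0"
      using False M_fin interior by (intro sum_telescope_ereal) auto
    finally show ?thesis .
  qed
  have "(p + M ?d) - (q + M 0) = (p - q) + (M ?d - M 0)"
    using pq_fin M_fin[of 0] M_fin[of ?d]
    by (cases p; cases q; cases "M 0"; cases "M ?d") auto
  then show ?thesis
    unfolding sum_mu cavity_def Jx J0 by (simp only: p_def q_def)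
qed

end
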